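(* Let $k:S^{1}\times[0,T)\rightarrow\mathbb{R}$ be a function with $k\in C^{2+\alpha,1+\alpha}(S^{1}\times[0,T-\epsilon])$ for all $\epsilon>0$, satisfying the evolution equation $$\frac{\partial k}{\partial t}=\frac{a}{a+a''}k^{2}\frac{\partial^{2}k}{\partial\theta^{2}}+\frac{2a'}{a+a''}k^{2}\frac{\partial k}{\partial\theta}+k^{3}$$ with initial value $k(\theta,0)=\varphi(\theta)$, where $\varphi$ is a strictly positive $C^{1+\alpha}$ function such that $$\int_{0}^{2\pi}\frac{a(\theta)+a''(\theta)}{\varphi(\theta)}\sin\theta\,d\theta=\int_{0}^{2\pi}\frac{a(\theta)+a''(\theta)}{\varphi(\theta)}\cos\theta\,d\theta=0.$$ Then, using this function, one can build the family of curves (in the parameter $t$) $$F(\theta,t)=\left(-\int_{0}^{\theta}\frac{a(\sigma)+a''(\sigma)}{k(\sigma,t)}\sin\sigma\,d\sigma-\int_{0}^{t}a(0)k(0,s)\,ds,\ \int_{0}^{\theta}\frac{a(\sigma)+a''(\sigma)}{k(\sigma,t)}\cos\sigma\,d\sigma-\int_{0}^{t}\Big(a(0)\frac{\partial k}{\partial\sigma}(0,s)+a'(0)k(0,s)\Big)ds\right)$$ for which the following hold: (a) for each fixed $t$ the map $\theta\mapsto F(\theta,t)$ is a simple closed strictly convex curve, parameterized so that the tangent vector at $\theta$ points in the $q(\theta)$ direction, whose Minkowski curvature is given by $\theta\mapsto k(\theta,t)$; (b) $\displaystyle\frac{\partial F}{\partial t}(\theta,t)=-k(\theta,t)p(\theta)-a^{2}(\theta)\frac{\partial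 k}{\partial\theta}(\theta,t)q(\theta)$.
   Context: $[\cdot,\cdot]$ denotes the determinant of two vectors of $\mathbb{R}^2$; $e_r=(\cos\theta,\sin\theta)$, $e_\theta=(-\sin\theta,\cos\theta)$; a prime denotes $d/d\theta$. $\mathcal{P}\subset\mathbb{R}^2$ is a strictly convex set, symmetric with respect to the origin, whose boundary is a $C^\infty$ curve $p(\theta)=a(\theta)e_r+a'(\theta)e_\theta$, where $a$ is the support function of $\mathcal{P}$; so $p'=(a+a'')e_\theta$ and $[p,p']=a(a+a'')$. It is assumed that $a+a''>0$ for all $\theta$. The dual unit ball $\mathcal{Q}$ has boundary $q(\theta)=p'(\theta)/[p(\theta),p'(\theta)]=\frac{1}{a(\theta)}e_\theta$. A closed strictly convex curve $\gamma$ parameterized by $\theta$ so that $\gamma'(\theta)=\lambda(\theta)q(\theta)$ with $\lambda>0$ has Minkowski curvature $k(\theta)=[p,p']/\lambda(\theta)$. $S^1=\mathbb{R}/2\pi\mathbb{Z}$, $0<\alpha<1$, and $C^{2+\alpha,1+\alpha}$, $C^{1+\alpha}$ are Hölder classes: the former consists of functions that are twice differentiable in $\theta$ and once in $t$ with $\alpha$-Hölder continuous derivatives of these orders. The variables $\theta$ and $t$ are independent. *)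

theory Defs
  imports "HOL-Analysis.Analysis"
begin

definition e_r :: "real \<Rightarrow> real ^ 2" where
  "e_r \<theta> = vector [cos \<theta>, sin \<theta>]"

definition e_theta :: "real \<Rightarrow> real ^ 2" where
  "e_theta \<theta> = vector [- sin \<theta>, cos \<theta>]"

definition det2 :: "real ^ 2 \<Rightarrow> real ^ 2 \<Rightarrow> real" where
  "det2 u v = det (vector [u, v] :: real ^ 2 ^ 2)"


text \<open>The condition is imposed on the closure so that it also says the right thing for sets
  that are not closed; it implies convexity.\<close>

definition strictly_convex :: "'a::euclidean_space set \<Rightarrow> bool" where
  "strictly_convex S \<longleftrightarrow>
     (\<forall>x\<in>closure S. \<forall>y\<in>closure S. x \<noteq> y \<longrightarrow> open_segment x y \<subseteq> interior S)"

text \<open>The support function, in terms of the angle of the unit normal.  It is used only for nonempty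
  bounded sets: a convex set of the plane whose boundary is a nonempty bounded set is bounded.\<close>

definition support_function :: "(real ^ 2) set \<Rightarrow> real \<Rightarrow> real" where
  "support_function P \<theta> = (SUP x\<in>P. x \<bullet> e_r \<theta>)"

definition smooth_curve :: "(real \<Rightarrow> 'a::real_normed_vector) \<Rightarrow> bool" where
  "smooth_curve \<gamma> \<longleftrightarrow>
     (\<exists>D. D (0::nat) = \<gamma> \<and> (\<forall>n \<theta>. (D n has_vector_derivative D (Suc n) \<theta>) (at \<theta>)))"

definition p_curve :: "(real \<Rightarrow> real) \<Rightarrow> real \<Rightarrow> real ^ 2" where
  "p_curve a \<theta> = a \<theta> *\<^sub>R e_r \<theta> + deriv a \<theta> *\<^sub>R e_theta \<theta>"

definition p_curve' :: "(real \<Rightarrow> real) \<Rightarrow> real \<Rightarrow> real ^ 2" where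
  "p_curve' a \<theta> = vector_derivative (p_curve a) (at \<theta>)"

definition q_curve :: "(real \<Rightarrow> real) \<Rightarrow> real \<Rightarrow> real ^ 2" where
  "q_curve a \<theta> = (1 / det2 (p_curve a \<theta>) (p_curve' a \<theta>)) *\<^sub>R p_curve' a \<theta>"


text \<open>Functions on the circle are rendered as functions on the line of period \<open>2 * pi\<close>, and closed
  curves likewise.\<close>

definition simple_closed_curve :: "(real \<Rightarrow> real ^ 2) \<Rightarrow> bool" where
  "simple_closed_curve \<gamma> \<longleftrightarrow>
     (\<forall>\<theta>. \<gamma> (\<theta> + 2 * pi) = \<gamma> \<theta>) \<and> simple_path (\<lambda>s. \<gamma> (2 * pi * s))"

definition strictly_convex_curve :: "(real \<Rightarrow> real ^ 2) \<Rightarrow> bool" where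
  "strictly_convex_curve \<gamma> \<longleftrightarrow>
     (\<exists>K. compact K \<and> strictly_convex K \<and> interior K \<noteq> {} \<and> frontier K = range \<gamma>)"

text \<open>The curve \<open>\<gamma>\<close> is parameterized so that its tangent at \<open>\<theta>\<close> is a positive multiple \<open>l \<theta>\<close> of
  \<open>q \<theta>\<close>, and its Minkowski curvature in this parameterization is \<open>\<kappa>\<close>.\<close>

definition has_minkowski_curvature ::
  "(real \<Rightarrow> real) \<Rightarrow> (real \<Rightarrow> real ^ 2) \<Rightarrow> (real \<Rightarrow> real) \<Rightarrow> bool" where
  "has_minkowski_curvature a \<gamma> \<kappa> \<longleftrightarrow>
     (\<exists>l. \<forall>\<theta>. l \<theta> > 0
        \<and> (\<gamma> has_vector_derivative l \<theta> *\<^sub>R q_curve a \<theta>) (at \<theta>)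
        \<and> \<kappa> \<theta> = det2 (p_curve a \<theta>) (p_curve' a \<theta>) / l \<theta>)"


definition holder_on :: "real \<Rightarrow> 'a::metric_space set \<Rightarrow> ('a \<Rightarrow> real) \<Rightarrow> bool" where
  "holder_on \<alpha> S f \<longleftrightarrow> (\<exists>C. \<forall>x\<in>S. \<forall>y\<in>S. \<bar>f x - f y\<bar> \<le> C * dist x y powr \<alpha>)"

text \<open>The class \<open>C\<^sup>1\<^sup>+\<^sup>\<alpha>\<close> on the circle.  For periodic functions, being Hoelder continuous with respect
  to the distance of the line and of the circle amounts to the same.\<close>

definition holder_C1 :: "real \<Rightarrow> (real \<Rightarrow> real) \<Rightarrow> bool" where
  "holder_C1 \<alpha> f \<longleftrightarrow>
     (\<forall>\<theta>. f (\<theta> + 2 * pi) = f \<theta>) \<and>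
     (\<exists>f'. (\<forall>\<theta>. (f has_real_derivative f' \<theta>) (at \<theta>)) \<and> holder_on \<alpha> UNIV f')"

text \<open>The class \<open>C\<^sup>2\<^sup>+\<^sup>\<alpha>\<^sup>,\<^sup>1\<^sup>+\<^sup>\<alpha>\<close> on the product of the circle with \<open>[0, \<tau>]\<close>: two derivatives in the
  first variable, one (one-sided at the end points) in the second, and the derivatives of these
  orders Hoelder continuous with exponent \<open>\<alpha>\<close> in both variables jointly.  The lower-order derivatives
  are then Hoelder continuous as well.\<close>

definition holder_C2_C1 :: "real \<Rightarrow> real \<Rightarrow> (real \<Rightarrow> real \<Rightarrow> real) \<Rightarrow> bool" where
  "holder_C2_C1 \<alpha> \<tau> k \<longleftrightarrow>
     (\<forall>\<theta>. \<forall>t\<in>{0..\<tau>}. k (\<theta> + 2 * pi) t = k \<theta> t) \<and>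
     (\<exists>k1 k2 kt.
        (\<forall>\<theta>. \<forall>t\<in>{0..\<tau>}.
           ((\<lambda>x. k x t) has_real_derivative k1 \<theta> t) (at \<theta>) \<and>
           ((\<lambda>x. k1 x t) has_real_derivative k2 \<theta> t) (at \<theta>) \<and>
           ((\<lambda>s. k \<theta> s) has_real_derivative kt \<theta> t) (at t within {0..\<tau>})) \<and>
        holder_on \<alpha> (UNIV \<times> {0..\<tau>}) (\<lambda>(\<theta>, t). k2 \<theta> t) \<and>
        holder_on \<alpha> (UNIV \<times> {0..\<tau>}) (\<lambda>(\<theta>, t). kt \<theta> t))"

definition d_theta :: "(real \<Rightarrow> real \<Rightarrow> real) \<Rightarrow> real \<Rightarrow> real \<Rightarrow> real" where
  "d_theta k \<theta> t = deriv (\<lambda>x. k x t) \<theta>"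

definition minkowski_flow ::
  "(real \<Rightarrow> real) \<Rightarrow> (real \<Rightarrow> real \<Rightarrow> real) \<Rightarrow> real \<Rightarrow> real \<Rightarrow> real ^ 2" where
  "minkowski_flow a k \<theta> t = vector
     [- (LBINT \<sigma>=0..\<theta>. (a \<sigma> + deriv (deriv a) \<sigma>) / k \<sigma> t * sin \<sigma>)
        - (LBINT s=0..t. a 0 * k 0 s),
      (LBINT \<sigma>=0..\<theta>. (a \<sigma> + deriv (deriv a) \<sigma>) / k \<sigma> t * cos \<sigma>)
        - (LBINT s=0..t. a 0 * d_theta k 0 s + deriv a 0 * k 0 s)]"

end

theory Submission
  imports Defs
begin

text \<open>Write \<open>g = a + a''\<close> for the radius of curvature of the unit ball and \<open>e\<^sub>r, e\<^sub>\<theta>\<close> for the rotating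
  frame.  Everything rests on the function \<open>u = a k\<close>: after multiplication by \<open>g / k\<^sup>2\<close> the evolution
  equation becomes \<open>- (g / k)\<^sub>t = u'' + u\<close>, where the prime is the derivative in \<open>\<theta>\<close>.  The operator on
  the right annihilates sine and cosine, so that for \<open>w = sin\<close> or \<open>w = cos\<close> the product
  \<open>(u'' + u) w\<close> is the derivative of the periodic function \<open>u' w - u w'\<close>.  Differentiation under the
  integral sign then has two consequences (\<open>density_moment_deriv\<close>).  Over a full period the moments
  of \<open>g / k\<close> against sine and cosine do not depend on time, so a curve that closes up at time \<open>0\<close>
  closes up at every time.  Over \<open>[0, \<theta>]\<close> the time derivative is explicit; the contributions at the
  end point \<open>0\<close> cancel against the integrals over time in the definition of the flow, and what
  remains is the velocity \<open>- u e\<^sub>r - u' e\<^sub>\<theta> = - k p - a\<^sup>2 k' q\<close>.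

  All this needs \<open>k > 0\<close>.  If \<open>k\<close> came down to a positive level \<open>c\<close> below its initial minimum, then at
  the first contact \<open>k\<close> would have a minimum in \<open>\<theta>\<close>, and the equation would give
  \<open>k\<^sub>t \<ge> c\<^sup>3 > 0\<close>, whereas \<open>k\<close> has just decreased to \<open>c\<close> (\<open>periodic_barrier\<close>, \<open>k_pos\<close>).  The sign of the
  coefficient of \<open>k''\<close>, and the very formula \<open>q = e\<^sub>\<theta> / a\<close>, also need \<open>a > 0\<close>; this follows from
  \<open>g > 0\<close> and the central symmetry (\<open>a_pos\<close>).

  At a fixed time the flow has velocity \<open>(g / k) e\<^sub>\<theta>\<close> in \<open>\<theta>\<close>.  For any closed curve whose velocity is a
  positive multiple of \<open>e\<^sub>\<theta>\<close>, the height in the direction \<open>e\<^sub>r(\<theta>)\<close> increases on the half period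
  before \<open>\<theta>\<close> and decreases on the half period after it.  Each point of the curve is therefore the
  unique highest point in its own normal direction.  This makes the curve simple, and makes it the
  boundary of its convex hull, which is strictly convex (\<open>frame_tangent_curve\<close>).\<close>

section \<open>Calculus in the rotating frame\<close>

lemma inner_vector_2: "(vector [x, y] :: real ^ 2) \<bullet> vector [u, v] = x * u + y * v"
  by (simp add: inner_vec_def sum_2)

lemma has_vector_derivative_vector_2:
  assumes "(f has_real_derivative f') (at x within S)" "(g has_real_derivative g') (at x within S)"
  shows "((\<lambda>x. vector [f x, g x] :: real ^ 2) has_vector_derivative vector [f', g']) (at x within S)"
proof -
  have eq: "(vector [u, v] :: real ^ 2) = u *\<^sub>R axis 1 1 + v *\<^sub>R axis 2 1" for u v
    by (simp add: vec_eq_iff forall_2 axis_def)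
  show ?thesis
    unfolding eq using assms
    by (auto intro!: derivative_eq_intros simp: has_real_derivative_iff_has_vector_derivative)
qed

lemma e_r_has_vector_derivative [derivative_intros]:
  "(e_r has_vector_derivative e_theta x) (at x within S)"
  unfolding e_r_def[abs_def] e_theta_def
  by (rule has_vector_derivative_vector_2) (auto intro!: derivative_eq_intros)

lemma e_theta_has_vector_derivative [derivative_intros]:
  "(e_theta has_vector_derivative - e_r x) (at x within S)"
proof -
  have "- e_r x = vector [- cos x, - sin x]"
    by (simp add: e_r_def vec_eq_iff forall_2)
  then show ?thesis
    unfolding e_theta_def[abs_def]
    by (auto intro!: has_vector_derivative_vector_2 derivative_eq_intros)
qed

lemma inner_frame [simp]:
  "e_r x \<bullet> e_r x = 1" "e_theta x \<bullet> e_theta x = 1" "e_r x \<bullet> e_theta x = 0" "e_theta x \<bullet> e_r x = 0"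
  by (simp_all add: e_r_def e_theta_def inner_vector_2 flip: power2_eq_square)

lemma inner_e_theta_e_r: "e_theta s \<bullet> e_r \<theta> = - sin (s - \<theta>)"
  by (simp add: e_r_def e_theta_def inner_vector_2 sin_diff)

lemma e_r_antipodal: "e_r (\<theta> + pi) = - e_r \<theta>"
  by (simp add: e_r_def vec_eq_iff forall_2)

lemma det2_eq: "det2 u v = u $ 1 * v $ 2 - u $ 2 * v $ 1"
  by (simp add: det2_def det_2)

lemma vector_eq_norm_e_r:
  fixes v :: "real ^ 2"
  obtains \<theta> where "v = norm v *\<^sub>R e_r \<theta>"
proof -
  obtain r t where "Complex (v $ 1) (v $ 2) = rcis r t" "r = cmod (Complex (v $ 1) (v $ 2))"
    by (metis rcis_cmod_Arg)
  then have "v $ 1 = r * cos t" "v $ 2 = r * sin t" "r = norm v"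
    by (auto simp: complex_eq_iff cmod_def norm_vec_def L2_set_def sum_2)
  then have "v = norm v *\<^sub>R e_r t"
    by (simp add: e_r_def vec_eq_iff forall_2)
  then show thesis by (rule that)
qed

text \<open>The position \<open>c\<close> of the window is free: compactness arguments use \<open>[0, 2\<pi>]\<close>, comparisons of
  heights use a window centred at the angle under consideration.\<close>
lemma periodic_2pi_representative:
  fixes f :: "real \<Rightarrow> 'a"
  assumes "\<And>x. f (x + 2 * pi) = f x"
  obtains y where "c \<le> y" "y < c + 2 * pi" "f y = f x"
proof -
  interpret periodic_fun_simple f "2 * pi"
    by standard (rule assms)
  define n where "n = \<lfloor>(x - c) / (2 * pi)\<rfloor>"
  have "of_int n \<le> (x - c) / (2 * pi)" "(x - c) / (2 * pi) < of_int n + 1"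
    unfolding n_def by linarith+
  then have "c \<le> x - of_int n * (2 * pi)" "x - of_int n * (2 * pi) < c + 2 * pi"
    by (simp_all add: field_simps)
  then show thesis
    by (rule that) (rule minus_of_int)
qed

lemma vector_derivative_of_periodic:
  assumes "\<And>x. f (x + d) = f x" "\<And>x. (f has_vector_derivative f' x) (at x)"
  shows "f' (x + d) = f' x"
proof -
  have "((\<lambda>x. f (x + d)) has_vector_derivative f' (x + d)) (at x)"
    using assms(2)[of "x + d"]
    by (auto intro!: vector_diff_chain_at[where f="\<lambda>x. x + d" and g=f and f'=1, simplified o_def scaleR_one]
        derivative_eq_intros)
  then show ?thesis
    unfolding assms(1) using assms(2) vector_derivative_unique_at by blast
qed

section \<open>Closed curves with tangent along the rotating frame\<close>

text \<open>The parameter of such a curve is the angle of its outer normal \<open>e\<^sub>r\<close>, and \<open>\<rho>\<close> is its radius of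
  curvature.\<close>
locale frame_tangent_curve =
  fixes \<gamma> :: "real \<Rightarrow> real ^ 2" and \<rho> :: "real \<Rightarrow> real"
  assumes periodic: "\<gamma> (\<theta> + 2 * pi) = \<gamma> \<theta>"
    and pos: "\<rho> \<theta> > 0"
    and deriv: "(\<gamma> has_vector_derivative \<rho> \<theta> *\<^sub>R e_theta \<theta>) (at \<theta>)"
begin

text \<open>The height of \<open>\<gamma> s\<close> in the direction \<open>e\<^sub>r(\<theta>)\<close> has derivative \<open>- \<rho> s * sin (s - \<theta>)\<close>, which is
  positive before \<open>\<theta>\<close> and negative after it, up to the distance \<open>\<pi>\<close>.\<close>
lemma height_less_near:
  assumes "s \<in> {\<theta> - pi..\<theta> + pi}" "s \<noteq> \<theta>"
  shows "\<gamma> s \<bullet> e_r \<theta> < \<gamma> \<theta> \<bullet> e_r \<theta>"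
proof -
  let ?f = "\<lambda>s. \<gamma> s \<bullet> e_r \<theta>"
  have D: "(?f has_real_derivative - \<rho> x * sin (x - \<theta>)) (at x)" for x
    using bounded_linear.has_vector_derivative[OF bounded_linear_inner_left[of "e_r \<theta>"] deriv[of x]]
    by (simp add: has_real_derivative_iff_has_vector_derivative inner_e_theta_e_r)
  have cont: "continuous_on A ?f" for A
    by (intro continuous_at_imp_continuous_on ballI DERIV_isCont[OF D])
  show ?thesis
  proof (cases "s < \<theta>")
    case True
    have "0 < - \<rho> x * sin (x - \<theta>)" if "s < x" "x < \<theta>" for x
    proof -
      have "sin (\<theta> - x) > 0" using that assms by (intro sin_gt_zero) auto
      then show ?thesis using pos[of x] sin_minus[of "\<theta> - x"] by simp
    qed
    then show ?thesis
      using DERIV_pos_imp_increasing_open[OF True, of ?f] D cont by blast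
  next
    case False
    then have "\<theta> < s" using assms by auto
    moreover have "- \<rho> x * sin (x - \<theta>) < 0" if "\<theta> < x" "x < s" for x
    proof -
      have "sin (x - \<theta>) > 0" using that assms by (intro sin_gt_zero) auto
      then show ?thesis using pos[of x] by simp
    qed
    ultimately show ?thesis
      using DERIV_neg_imp_decreasing_open[of \<theta> s ?f] D cont by blast
  qed
qed

lemma height_less: "\<gamma> s = \<gamma> \<theta> \<or> \<gamma> s \<bullet> e_r \<theta> < \<gamma> \<theta> \<bullet> e_r \<theta>"
proof -
  obtain y where "\<theta> - pi \<le> y" "y < \<theta> - pi + 2 * pi" "\<gamma> y = \<gamma> s"
    using periodic_2pi_representative[of \<gamma> "\<theta> - pi" s] periodic by metis
  then show ?thesis
    using height_less_near[of y \<theta>] by (cases "y = \<theta>") auto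
qed

text \<open>Two parameters less than a period apart are, after a shift by \<open>2\<pi>\<close> if necessary, at most \<open>\<pi>\<close>
  apart, and then the heights in the normal direction of one of them differ.\<close>
lemma injective_on_period:
  assumes "s < s'" "s' < s + 2 * pi"
  shows "\<gamma> s \<noteq> \<gamma> s'"
proof (cases "s' \<le> s + pi")
  case True
  then show ?thesis using height_less_near[of s' s] assms by auto
next
  case False
  then show ?thesis using height_less_near[of "s' - 2 * pi" s] periodic[of "s' - 2 * pi"] assms by auto
qed

lemma continuous_on_curve: "continuous_on A \<gamma>"
  by (intro continuous_at_imp_continuous_on ballI has_vector_derivative_continuous[OF deriv])

lemma simple_closed: "simple_closed_curve \<gamma>"
proof -
  have "path (\<lambda>s. \<gamma> (2 * pi * s))"
    unfolding path_def by (intro continuous_on_compose2[OF continuous_on_curve[of UNIV]] continuous_intros) auto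
  moreover have "x = y \<or> x = 0 \<and> y = 1"
    if "x \<in> {0..1}" "y \<in> {0..1}" "\<gamma> (2 * pi * x) = \<gamma> (2 * pi * y)" "x \<le> y" for x y :: real
  proof (rule ccontr)
    assume "\<not> ?thesis"
    then have "x < y" "y < x + 1" using that by auto
    moreover have "2 * pi * y < 2 * pi * (x + 1)"
      using \<open>y < x + 1\<close> by (intro mult_strict_left_mono) auto
    ultimately show False
      using injective_on_period[of "2 * pi * x" "2 * pi * y"] that by (simp add: distrib_left)
  qed
  then have "loop_free (\<lambda>s. \<gamma> (2 * pi * s))"
    unfolding loop_free_def by (metis linear)
  ultimately show ?thesis
    unfolding simple_closed_curve_def simple_path_def using periodic by auto
qed

lemma compact_range: "compact (range \<gamma>)"
proof -
  have "range \<gamma> = \<gamma> ` {0..2 * pi}"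
  proof
    show "range \<gamma> \<subseteq> \<gamma> ` {0..2 * pi}"
    proof
      fix v assume "v \<in> range \<gamma>"
      then obtain x where x: "v = \<gamma> x" by auto
      obtain y where "0 \<le> y" "y < 0 + 2 * pi" "\<gamma> y = \<gamma> x"
        using periodic_2pi_representative[of \<gamma> 0 x] periodic by metis
      then show "v \<in> \<gamma> ` {0..2 * pi}"
        using x by (intro image_eqI[of _ _ y]) auto
    qed
  qed auto
  then show ?thesis
    using compact_continuous_image[OF continuous_on_curve compact_Icc] by metis
qed

text \<open>An open half-plane together with a single point of its boundary line is convex.  Keeping only that
  point, rather than the closed half-plane, shows that the supporting line meets the hull in no
  other point; the strict convexity comes from here.\<close>
lemma hull_subset_half_plane:
  "convex hull (range \<gamma>) \<subseteq> insert (\<gamma> \<theta>) {y. y \<bullet> e_r \<theta> < \<gamma> \<theta> \<bullet> e_r \<theta>}"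
proof (rule hull_minimal)
  show "range \<gamma> \<subseteq> insert (\<gamma> \<theta>) {y. y \<bullet> e_r \<theta> < \<gamma> \<theta> \<bullet> e_r \<theta>}"
    using height_less[of _ \<theta>] by auto
  show "convex (insert (\<gamma> \<theta>) {y. y \<bullet> e_r \<theta> < \<gamma> \<theta> \<bullet> e_r \<theta>})"
  proof (rule convexI)
    fix x y :: "real ^ 2" and u v :: real
    let ?H = "insert (\<gamma> \<theta>) {y. y \<bullet> e_r \<theta> < \<gamma> \<theta> \<bullet> e_r \<theta>}"
    assume *: "x \<in> ?H" "y \<in> ?H" "0 \<le> u" "0 \<le> v" "u + v = 1"
    let ?c = "\<gamma> \<theta> \<bullet> e_r \<theta>"
    consider "x = \<gamma> \<theta>" "y = \<gamma> \<theta>" | "u = 0" | "v = 0"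
      | "0 < u" "0 < v" "x \<bullet> e_r \<theta> < ?c \<and> y \<bullet> e_r \<theta> \<le> ?c \<or> x \<bullet> e_r \<theta> \<le> ?c \<and> y \<bullet> e_r \<theta> < ?c"
      using * by force
    then show "u *\<^sub>R x + v *\<^sub>R y \<in> ?H"
    proof cases
      case 1
      then show ?thesis using * by (simp flip: scaleR_left_distrib)
    next
      case 4
      have "u * (x \<bullet> e_r \<theta>) + v * (y \<bullet> e_r \<theta>) < u * ?c + v * ?c"
        using 4 by (smt (verit) mult_left_mono mult_strict_left_mono)
      also have "\<dots> = ?c" using * by (metis distrib_right mult_1)
      finally show ?thesis by (simp add: inner_add_left)
    qed (use * in auto)
  qed
qed

text \<open>Only the angle of a supporting line matters, and the point of contact is already determined by
  it.\<close>
lemma supporting_angle: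
  assumes "x \<in> convex hull (range \<gamma>)" "x \<notin> interior (convex hull (range \<gamma>))"
  obtains \<theta> where "x = \<gamma> \<theta>"
    "\<And>y. y \<in> convex hull (range \<gamma>) \<Longrightarrow> y \<bullet> e_r \<theta> \<le> x \<bullet> e_r \<theta>"
proof -
  let ?K = "convex hull (range \<gamma>)"
  \<comment> \<open>Supporting hyperplanes are available at relative boundary points; a hull without interior lies
    in a line and is supported by it.\<close>
  have "\<exists>v. v \<noteq> 0 \<and> (\<forall>y\<in>?K. v \<bullet> y \<le> v \<bullet> x)"
  proof (cases "interior ?K = {}")
    case True
    then obtain v b where "v \<noteq> 0" "?K \<subseteq> {x. v \<bullet> x = b}"
      using empty_interior_subset_hyperplane[of ?K] convex_convex_hull by metis
    then have "v \<bullet> y = b" if "y \<in> ?K" for y using that by blast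
    then show ?thesis using assms(1) \<open>v \<noteq> 0\<close> by (intro exI[of _ v]) simp
  next
    case False
    then have "x \<notin> rel_interior ?K"
      using assms by (simp add: rel_interior_nonempty_interior)
    then obtain v where "v \<noteq> 0" "\<And>y. y \<in> ?K \<Longrightarrow> v \<bullet> x \<le> v \<bullet> y"
      using supporting_hyperplane_rel_boundary[OF convex_convex_hull assms(1)] by metis
    then show ?thesis by (intro exI[of _ "- v"]) auto
  qed
  then obtain v where v: "v \<noteq> 0" "\<And>y. y \<in> ?K \<Longrightarrow> v \<bullet> y \<le> v \<bullet> x" by blast
  obtain \<theta> where \<theta>: "v = norm v *\<^sub>R e_r \<theta>" using vector_eq_norm_e_r .
  have le: "y \<bullet> e_r \<theta> \<le> x \<bullet> e_r \<theta>" if "y \<in> ?K" for y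
  proof -
    have "norm v * (y \<bullet> e_r \<theta>) \<le> norm v * (x \<bullet> e_r \<theta>)"
      using v(2)[OF that] \<theta> by (metis inner_commute inner_scaleR_right)
    then show ?thesis using v(1) by simp
  qed
  have "\<gamma> \<theta> \<in> ?K" by (simp add: hull_inc)
  then have "x = \<gamma> \<theta>"
    using le hull_subset_half_plane[of \<theta>] assms(1) by fastforce
  then show thesis using le that by blast
qed

lemma frontier_hull: "frontier (convex hull (range \<gamma>)) = range \<gamma>"
proof -
  let ?K = "convex hull (range \<gamma>)"
  have cl: "closed ?K" using compact_range compact_convex_hull compact_imp_closed by blast
  have "\<gamma> \<theta> \<notin> interior ?K" for \<theta>
  proof
    assume "\<gamma> \<theta> \<in> interior ?K"
    moreover have "interior ?K \<subseteq> interior {y. e_r \<theta> \<bullet> y \<le> e_r \<theta> \<bullet> \<gamma> \<theta>}"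
      using hull_subset_half_plane[of \<theta>] by (intro interior_mono) (auto simp: inner_commute)
    moreover have "e_r \<theta> \<noteq> 0" using inner_frame(1)[of \<theta>] by fastforce
    ultimately show False using interior_halfspace_le[of "e_r \<theta>"] by auto
  qed
  moreover have "x \<in> range \<gamma>" if "x \<in> ?K" "x \<notin> interior ?K" for x
    by (rule supporting_angle[OF that]) (rule range_eqI)
  ultimately have "?K - interior ?K = range \<gamma>"
    using hull_subset[of "range \<gamma>" convex] by blast
  then show ?thesis
    by (simp only: frontier_def closure_closed[OF cl])
qed

text \<open>A boundary point inside a segment would be a highest point for some angle, and then so would both
  ends of the segment; but the highest point is unique.\<close>
lemma strictly_convex_hull: "strictly_convex (convex hull (range \<gamma>))"
proof -
  let ?K = "convex hull (range \<gamma>)"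
  have cl: "closed ?K" using compact_range compact_convex_hull compact_imp_closed by blast
  have "z \<in> interior ?K" if xy: "x \<in> ?K" "y \<in> ?K" "x \<noteq> y" and z: "z \<in> open_segment x y" for x y z
  proof (rule ccontr)
    assume nz: "z \<notin> interior ?K"
    have "z \<in> ?K" using xy z convex_contains_open_segment[of ?K] convex_convex_hull by blast
    then obtain \<theta> where \<theta>: "z = \<gamma> \<theta>" "\<And>y. y \<in> ?K \<Longrightarrow> y \<bullet> e_r \<theta> \<le> z \<bullet> e_r \<theta>"
      using supporting_angle nz by metis
    obtain u where u: "0 < u" "u < 1" "z = (1 - u) *\<^sub>R x + u *\<^sub>R y"
      using z by (auto simp: in_segment)
    have "z \<bullet> e_r \<theta> = (1 - u) * (x \<bullet> e_r \<theta>) + u * (y \<bullet> e_r \<theta>)"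
      by (simp add: u inner_add_left)
    then have "(1 - u) * (z \<bullet> e_r \<theta> - x \<bullet> e_r \<theta>) + u * (z \<bullet> e_r \<theta> - y \<bullet> e_r \<theta>) = 0"
      by (simp add: algebra_simps)
    then have "(1 - u) * (z \<bullet> e_r \<theta> - x \<bullet> e_r \<theta>) = 0 \<and> u * (z \<bullet> e_r \<theta> - y \<bullet> e_r \<theta>) = 0"
      using u \<theta>(2)[OF xy(1)] \<theta>(2)[OF xy(2)] by (subst (asm) add_nonneg_eq_0_iff) auto
    then have "x \<bullet> e_r \<theta> = \<gamma> \<theta> \<bullet> e_r \<theta>" "y \<bullet> e_r \<theta> = \<gamma> \<theta> \<bullet> e_r \<theta>"
      using u \<theta>(1) by auto
    then have "x = \<gamma> \<theta>" "y = \<gamma> \<theta>"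
      using xy hull_subset_half_plane[of \<theta>] by fastforce+
    then show False using xy by simp
  qed
  then show ?thesis
    unfolding strictly_convex_def closure_closed[OF cl] by blast
qed

lemma strictly_convex: "strictly_convex_curve \<gamma>"
proof -
  let ?K = "convex hull (range \<gamma>)"
  have "\<gamma> 0 \<noteq> \<gamma> pi" using injective_on_period[of 0 pi] by simp
  then have "open_segment (\<gamma> 0) (\<gamma> pi) \<noteq> {}" by simp
  moreover have "open_segment (\<gamma> 0) (\<gamma> pi) \<subseteq> interior ?K"
    using strictly_convex_hull \<open>\<gamma> 0 \<noteq> \<gamma> pi\<close> closure_subset[of ?K] hull_inc[of _ "range \<gamma>" convex]
    unfolding strictly_convex_def by blast
  ultimately have "interior ?K \<noteq> {}" by blast
  then show ?thesis
    unfolding strictly_convex_curve_def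
    using compact_convex_hull[OF compact_range] strictly_convex_hull frontier_hull by blast
qed

end

section \<open>The support function and the dual curve\<close>

text \<open>Since \<open>a = p \<bullet> e\<^sub>r\<close> and \<open>a' = p \<bullet> e\<^sub>\<theta>\<close>, where \<open>a'\<close> is at first only the default-valued \<open>deriv a\<close>,
  one derivative of \<open>p\<close> yields two derivatives of \<open>a\<close>.\<close>
lemma support_function_regular:
  assumes "smooth_curve (p_curve a)"
  shows "(a has_real_derivative deriv a x) (at x)"
    and "(deriv a has_real_derivative deriv (deriv a) x) (at x)"
    and "continuous_on UNIV (deriv (deriv a))"
proof -
  obtain D where D: "D (0::nat) = p_curve a" "\<And>n x. (D n has_vector_derivative D (Suc n) x) (at x)"
    using assms unfolding smooth_curve_def by blast
  define p' where "p' = D 1"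
  have p': "(p_curve a has_vector_derivative p' x) (at x)" for x
    using D(2)[of 0 x] by (simp add: D(1) p'_def)
  have cont_p': "continuous_on UNIV p'"
    unfolding p'_def
    by (intro continuous_at_imp_continuous_on ballI has_vector_derivative_continuous[OF D(2)])
  have a_eq: "a = (\<lambda>x. p_curve a x \<bullet> e_r x)" "deriv a = (\<lambda>x. p_curve a x \<bullet> e_theta x)"
    by (simp_all add: p_curve_def inner_add_left)
  note prod = bounded_bilinear.has_vector_derivative[OF bounded_bilinear_inner p']
  have Da: "(a has_real_derivative p_curve a x \<bullet> e_theta x + p' x \<bullet> e_r x) (at x)" for x
    by (subst a_eq(1)) (use prod[OF e_r_has_vector_derivative] in
      \<open>simp add: has_real_derivative_iff_has_vector_derivative\<close>)
  then show "(a has_real_derivative deriv a x) (at x)" for x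
    using DERIV_deriv_iff_has_field_derivative by blast
  have "(deriv a has_real_derivative p' x \<bullet> e_theta x - p_curve a x \<bullet> e_r x) (at x)" for x
    by (subst a_eq(2)) (use prod[OF e_theta_has_vector_derivative] in
      \<open>simp add: has_real_derivative_iff_has_vector_derivative\<close>)
  note Da' = this
  then show "(deriv a has_real_derivative deriv (deriv a) x) (at x)" for x
    using DERIV_deriv_iff_has_field_derivative by blast
  have "deriv (deriv a) = (\<lambda>x. p' x \<bullet> e_theta x - a x)"
    using DERIV_imp_deriv[OF Da'] a_eq(1) by (metis (no_types, lifting) ext)
  moreover have "continuous_on UNIV e_theta"
    by (intro continuous_at_imp_continuous_on ballI has_vector_derivative_continuous[OF e_theta_has_vector_derivative])
  moreover have "continuous_on UNIV a"
    by (intro continuous_at_imp_continuous_on ballI DERIV_isCont[OF Da])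
  ultimately show "continuous_on UNIV (deriv (deriv a))"
    using cont_p' by (auto intro!: continuous_intros)
qed

lemma support_function_antipodal:
  assumes "\<forall>x\<in>P. - x \<in> P"
  shows "support_function P (\<theta> + pi) = support_function P \<theta>"
proof -
  have "(\<lambda>x. x \<bullet> e_r (\<theta> + pi)) ` P = (\<lambda>x. x \<bullet> e_r \<theta>) ` P"
    using assms by (force simp: e_r_antipodal image_iff)
  then show ?thesis by (simp add: support_function_def)
qed

text \<open>What the construction uses of the unit ball: its support function, with central symmetry in the
  form of the period \<open>\<pi>\<close>.\<close>
locale minkowski_ball =
  fixes a :: "real \<Rightarrow> real"
  assumes a_deriv: "(a has_real_derivative deriv a x) (at x)"
    and a_deriv2: "(deriv a has_real_derivative deriv (deriv a) x) (at x)"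
    and a_deriv2_continuous: "continuous_on UNIV (deriv (deriv a))"
    and a_antipodal: "a (x + pi) = a x"
    and radius_pos: "a x + deriv (deriv a) x > 0"
begin

text \<open>The integral of \<open>(a + a'') sin (s - x)\<close> over \<open>s \<in> [x, x + \<pi>]\<close> is positive, and it equals
  \<open>a x + a (x + \<pi>) = 2 a x\<close>.\<close>
lemma a_pos: "a x > 0"
proof -
  let ?F = "\<lambda>s. deriv a s * sin (s - x) - a s * cos (s - x)"
  have D: "(?F has_real_derivative (a s + deriv (deriv a) s) * sin (s - x)) (at s)" for s
    by (auto intro!: derivative_eq_intros a_deriv a_deriv2 simp: algebra_simps)
  have "?F x < ?F (x + pi)"
  proof (rule DERIV_pos_imp_increasing_open[of x "x + pi" ?F])
    show "\<exists>y. DERIV ?F s :> y \<and> 0 < y" if "x < s" "s < x + pi" for s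
      using D[of s] radius_pos[of s] sin_gt_zero[of "s - x"] that by (auto intro!: mult_pos_pos)
    show "continuous_on {x..x + pi} ?F"
      by (intro continuous_at_imp_continuous_on ballI DERIV_isCont[OF D])
  qed simp
  then show ?thesis using a_antipodal[of x] by simp
qed

lemma a_continuous: "continuous_on A a" "continuous_on A (deriv a)"
  "continuous_on A (\<lambda>x. a x + deriv (deriv a) x)"
proof -
  show "continuous_on A a" "continuous_on A (deriv a)"
    by (intro continuous_at_imp_continuous_on ballI DERIV_isCont[OF a_deriv] DERIV_isCont[OF a_deriv2])+
  then show "continuous_on A (\<lambda>x. a x + deriv (deriv a) x)"
    using continuous_on_subset[OF a_deriv2_continuous] by (intro continuous_on_add) auto
qed

lemma a_periodic: "a (x + 2 * pi) = a x" "deriv a (x + 2 * pi) = deriv a x"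
  "deriv (deriv a) (x + 2 * pi) = deriv (deriv a) x"
proof -
  show *: "a (x + 2 * pi) = a x" for x
    using a_antipodal[of x] a_antipodal[of "x + pi"] by (simp add: algebra_simps)
  show **: "deriv a (x + 2 * pi) = deriv a x" for x
    by (rule vector_derivative_of_periodic[of a "2 * pi" "deriv a", OF *])
      (rule a_deriv[unfolded has_real_derivative_iff_has_vector_derivative])
  show "deriv (deriv a) (x + 2 * pi) = deriv (deriv a) x"
    by (rule vector_derivative_of_periodic[of "deriv a" "2 * pi" "deriv (deriv a)", OF **])
      (rule a_deriv2[unfolded has_real_derivative_iff_has_vector_derivative])
qed

lemma p_curve'_eq: "p_curve' a x = (a x + deriv (deriv a) x) *\<^sub>R e_theta x"
proof -
  have "(p_curve a has_vector_derivative (a x + deriv (deriv a) x) *\<^sub>R e_theta x) (at x)"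
    unfolding p_curve_def[abs_def]
    by (auto intro!: derivative_eq_intros a_deriv a_deriv2 simp: algebra_simps)
  then show ?thesis
    unfolding p_curve'_def by (rule vector_derivative_at)
qed

lemma det2_p_p': "det2 (p_curve a x) (p_curve' a x) = a x * (a x + deriv (deriv a) x)"
proof -
  have "det2 (p_curve a x) (p_curve' a x)
      = a x * (a x + deriv (deriv a) x) * ((sin x)\<^sup>2 + (cos x)\<^sup>2)"
    by (simp only: p_curve'_eq) (simp add: det2_eq p_curve_def e_r_def e_theta_def power2_eq_square algebra_simps
        del: sin_cos_squared_add3)
  then show ?thesis by simp
qed

lemma q_curve_eq: "q_curve a x = (1 / a x) *\<^sub>R e_theta x"
  unfolding q_curve_def det2_p_p' unfolding p_curve'_eq using radius_pos[of x] by simp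

end

section \<open>Functions of space and time\<close>

lemma holder_on_imp_continuous_on:
  assumes "holder_on \<alpha> S f" "0 < \<alpha>"
  shows "continuous_on S f"
proof -
  obtain C where C: "\<And>x y. x \<in> S \<Longrightarrow> y \<in> S \<Longrightarrow> \<bar>f x - f y\<bar> \<le> C * dist x y powr \<alpha>"
    using assms unfolding holder_on_def by blast
  show ?thesis
    unfolding continuous_on_def
  proof (intro ballI)
    fix x assume x: "x \<in> S"
    have "((\<lambda>y. dist y x powr \<alpha>) \<longlongrightarrow> dist x x powr \<alpha>) (at x within S)"
      using assms by (intro tendsto_powr' tendsto_intros) auto
    then have "((\<lambda>y. C * dist y x powr \<alpha>) \<longlongrightarrow> 0) (at x within S)"
      using tendsto_mult_right_zero by fastforce
    moreover have "\<forall>\<^sub>F y in at x within S. norm (f y - f x) \<le> C * dist y x powr \<alpha>"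
      unfolding eventually_at_filter using C x by (auto intro!: always_eventually)
    ultimately have "((\<lambda>y. f y - f x) \<longlongrightarrow> 0) (at x within S)"
      by (rule Lim_null_comparison[rotated])
    then show "(f \<longlongrightarrow> f x) (at x within S)"
      by (simp add: LIM_zero_iff)
  qed
qed

text \<open>The fundamental theorem, rescaled to the fixed interval \<open>[0, 1]\<close>, writes \<open>f x t\<close> as
  \<open>f x 0 + t * integral (\<lambda>s. f' x (t * s))\<close>, and an integral over a fixed interval depends continuously
  on parameters.\<close>
lemma continuous_on_joint_of_partial_deriv:
  fixes f f' :: "real \<Rightarrow> real \<Rightarrow> real"
  assumes deriv: "\<And>x t. t \<in> {0..\<tau>} \<Longrightarrow> ((\<lambda>s. f x s) has_real_derivative f' x t) (at t within {0..\<tau>})"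
    and cont: "continuous_on (UNIV \<times> {0..\<tau>}) (\<lambda>(x, t). f' x t)"
    and init: "continuous_on UNIV (\<lambda>x. f x 0)"
  shows "continuous_on (UNIV \<times> {0..\<tau>}) (\<lambda>(x, t). f x t)"
proof -
  have in_slab: "t * s \<in> {0..\<tau>}" if "t \<in> {0..\<tau>}" "s \<in> {0..1}" for t s
    using that mult_mono[of t \<tau> s 1] by auto
  have eq: "f x t = f x 0 + t * integral (cbox 0 1) (\<lambda>s. f' x (t * s))" if t: "t \<in> {0..\<tau>}" for x t
  proof -
    have "((\<lambda>s. f x (t * s)) has_real_derivative f' x (t * s) * t) (at s within {0..1})"
      if s: "s \<in> {0..1}" for s
    proof -
      have "((*) t) ` {0..1} \<subseteq> {0..\<tau>}" using in_slab[OF t] by auto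
      then have "(f x has_real_derivative f' x (t * s)) (at (t * s) within ((*) t) ` {0..1})"
        using has_field_derivative_subset[OF deriv[OF in_slab[OF t s]]] by blast
      then show ?thesis
        using DERIV_image_chain[of "f x" "f' x (t * s)" "(*) t" s "{0..1}" t]
        by (auto simp: o_def intro!: derivative_eq_intros)
    qed
    then have "((\<lambda>s. f' x (t * s) * t) has_integral f x (t * 1) - f x (t * 0)) {0..1}"
      by (intro fundamental_theorem_of_calculus)
        (simp_all add: has_real_derivative_iff_has_vector_derivative)
    then have "f x t - f x 0 = integral {0..1} (\<lambda>s. f' x (t * s) * t)"
      using integral_unique[symmetric, of "\<lambda>s. f' x (t * s) * t"] by (simp del: integral_mult_left)
    then show ?thesis by (simp add: mult.commute)
  qed
  have "continuous_on ((UNIV \<times> {0..\<tau>}) \<times> cbox 0 1)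
      (\<lambda>z. (\<lambda>(x, t). f' x t) (fst (fst z), snd (fst z) * snd z))"
  proof (rule continuous_on_compose2[OF cont])
    show "continuous_on ((UNIV \<times> {0..\<tau>}) \<times> cbox 0 1)
        (\<lambda>z::(real \<times> real) \<times> real. (fst (fst z), snd (fst z) * snd z))"
      by (intro continuous_intros)
    show "(\<lambda>z. (fst (fst z), snd (fst z) * snd z)) ` ((UNIV \<times> {0..\<tau>}) \<times> cbox 0 1)
        \<subseteq> UNIV \<times> {0..\<tau>}"
      using in_slab by (simp add: image_subset_iff)
  qed
  then have "continuous_on ((UNIV \<times> {0..\<tau>}) \<times> cbox 0 1) (\<lambda>(p, s). f' (fst p) (snd p * s))"
    by (simp add: case_prod_unfold)
  then have "continuous_on (UNIV \<times> {0..\<tau>}) (\<lambda>p. integral (cbox 0 1) (\<lambda>s. f' (fst p) (snd p * s)))"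
    using integral_continuous_on_param[of "UNIV \<times> {0..\<tau>}" 0 1 "\<lambda>p s. f' (fst p) (snd p * s)"] by simp
  moreover have "continuous_on (UNIV \<times> {0..\<tau>}) (\<lambda>p. f (fst p) 0)"
    by (rule continuous_on_compose2[OF init continuous_on_fst[OF continuous_on_id]]) simp
  ultimately have "continuous_on (UNIV \<times> {0..\<tau>})
      (\<lambda>p. f (fst p) 0 + snd p * integral (cbox 0 1) (\<lambda>s. f' (fst p) (snd p * s)))"
    by (intro continuous_intros)
  then show ?thesis
  proof (rule continuous_on_eq)
    fix p :: "real \<times> real" assume "p \<in> UNIV \<times> {0..\<tau>}"
    then show "f (fst p) 0 + snd p * integral (cbox 0 1) (\<lambda>s. f' (fst p) (snd p * s)) = (\<lambda>(x, t). f x t) p"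
      unfolding case_prod_unfold by (intro eq[symmetric]) auto
  qed
qed

text \<open>Taylor's formula with integral remainder on \<open>[x, x + 1]\<close> expresses \<open>f1 x t\<close> through values of \<open>f\<close>
  and an integral of \<open>f2\<close>, all of which are continuous in \<open>t\<close>.\<close>
lemma continuous_on_partial_deriv_parameter:
  fixes f f1 f2 :: "real \<Rightarrow> real \<Rightarrow> real"
  assumes d1: "\<And>x t. t \<in> S \<Longrightarrow> ((\<lambda>x. f x t) has_real_derivative f1 x t) (at x)"
    and d2: "\<And>x t. t \<in> S \<Longrightarrow> ((\<lambda>x. f1 x t) has_real_derivative f2 x t) (at x)"
    and cont: "continuous_on (UNIV \<times> S) (\<lambda>(x, t). f2 x t)"
    and cont_f: "\<And>x. continuous_on S (f x)"
  shows "continuous_on S (f1 x)"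
proof -
  have eq: "f1 x t = f (x + 1) t - f x t - integral (cbox 0 1) (\<lambda>s. (1 - s) * f2 (x + s) t)" if t: "t \<in> S" for t
  proof -
    \<comment> \<open>antiderivative of the Taylor remainder in the variable \<open>s\<close>\<close>
    let ?F = "\<lambda>s. (1 - s) * f1 (x + s) t + f (x + s) t"
    have "(?F has_real_derivative (1 - s) * f2 (x + s) t) (at s within {0..1})" for s
      by (rule has_field_derivative_at_within)
        (auto intro!: derivative_eq_intros DERIV_chain2[OF d1[OF t]] DERIV_chain2[OF d2[OF t]])
    then have "((\<lambda>s. (1 - s) * f2 (x + s) t) has_integral ?F 1 - ?F 0) {0..1}"
      by (intro fundamental_theorem_of_calculus)
        (simp_all add: has_real_derivative_iff_has_vector_derivative)
    then show ?thesis by (simp add: integral_unique)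
  qed
  have "continuous_on (S \<times> cbox 0 1) (\<lambda>z. (\<lambda>(x, t). f2 x t) (x + snd z, fst z))"
    by (rule continuous_on_compose2[OF cont]) (auto intro!: continuous_intros)
  then have "continuous_on (S \<times> cbox 0 1) (\<lambda>z. (1 - snd z) * (\<lambda>(x, t). f2 x t) (x + snd z, fst z))"
    by (intro continuous_intros)
  then have "continuous_on S (\<lambda>t. integral (cbox 0 1) (\<lambda>s. (1 - s) * f2 (x + s) t))"
    by (intro integral_continuous_on_param) (simp add: case_prod_unfold)
  then have "continuous_on S (\<lambda>t. f (x + 1) t - f x t - integral (cbox 0 1) (\<lambda>s. (1 - s) * f2 (x + s) t))"
    by (intro continuous_intros cont_f)
  then show ?thesis
    by (rule continuous_on_eq) (auto intro: eq[symmetric, unfolded box_real])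
qed

lemma second_deriv_nonneg_at_minimum:
  fixes f f1 :: "real \<Rightarrow> real"
  assumes d1: "\<And>y. (f has_real_derivative f1 y) (at y)"
    and d2: "(f1 has_real_derivative c) (at x)"
    and min: "\<And>y. f x \<le> f y"
  shows "f1 x = 0" "0 \<le> c"
proof -
  show z: "f1 x = 0"
    using DERIV_local_min[OF d1, of 1] min by auto
  show "0 \<le> c"
  proof (rule ccontr)
    assume "\<not> 0 \<le> c"
    then obtain d where d: "d > 0" "\<And>h. 0 < h \<Longrightarrow> h < d \<Longrightarrow> f1 (x + h) < f1 x"
      using has_real_derivative_neg_dec_right[OF d2] by auto
    have "f (x + d / 2) < f x"
    proof (rule DERIV_neg_imp_decreasing_open[of x "x + d / 2" f])
      show "\<exists>y. DERIV f s :> y \<and> y < 0" if "x < s" "s < x + d / 2" for s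
        using d1[of s] d(2)[of "s - x"] that z by auto
      show "continuous_on {x..x + d / 2} f"
        by (intro continuous_at_imp_continuous_on ballI DERIV_isCont[OF d1])
    qed (use d in auto)
    then show False using min[of "x + d / 2"] by simp
  qed
qed

text \<open>A maximum principle.  Periodicity confines the set where \<open>k \<le> c\<close> to a compact rectangle, so
  it has an earliest point.  There \<open>k\<close> equals \<open>c\<close> and is minimal in space, so the barrier condition says
  that \<open>k\<close> is increasing in time, although it was above \<open>c\<close> before.\<close>
lemma periodic_barrier:
  fixes k k1 k2 kt :: "real \<Rightarrow> real \<Rightarrow> real"
  assumes d1: "\<And>x t. t \<in> {0..\<tau>} \<Longrightarrow> ((\<lambda>x. k x t) has_real_derivative k1 x t) (at x)"
    and d2: "\<And>x t. t \<in> {0..\<tau>} \<Longrightarrow> ((\<lambda>x. k1 x t) has_real_derivative k2 x t) (at x)"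
    and dt: "\<And>x t. t \<in> {0..\<tau>} \<Longrightarrow> ((\<lambda>s. k x s) has_real_derivative kt x t) (at t within {0..\<tau>})"
    and cont: "continuous_on (UNIV \<times> {0..\<tau>}) (\<lambda>(x, t). k x t)"
    and periodic: "\<And>x t. t \<in> {0..\<tau>} \<Longrightarrow> k (x + 2 * pi) t = k x t"
    and init: "\<And>x. c < k x 0"
    and barrier: "\<And>x t. \<lbrakk>t \<in> {0..\<tau>}; k x t = c; k1 x t = 0; 0 \<le> k2 x t\<rbrakk> \<Longrightarrow> 0 < kt x t"
    and t: "t \<in> {0..\<tau>}"
  shows "c < k x t"
proof (rule ccontr)
  assume "\<not> c < k x t"
  let ?R = "{0..2 * pi} \<times> {0..\<tau>}"
  let ?Z = "{z \<in> ?R. (\<lambda>(x, t). k x t) z \<le> c}"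
  have in_Z: "\<exists>y. (y, s) \<in> ?Z" if s: "s \<in> {0..\<tau>}" and "k y s \<le> c" for y s
  proof -
    obtain y' where "0 \<le> y'" "y' < 0 + 2 * pi" "k y' s = k y s"
      using periodic_2pi_representative[of "\<lambda>x. k x s" 0 y, OF periodic[OF s]] by auto
    then show ?thesis using that by (intro exI[of _ y']) auto
  qed
  have "?Z = ?R \<inter> (\<lambda>(x, t). k x t) -` {..c}" by auto
  moreover have "closed (?R \<inter> (\<lambda>(x, t). k x t) -` {..c})"
    by (intro continuous_closed_preimage continuous_on_subset[OF cont] closed_Times) auto
  moreover have "bounded ?Z"
    by (rule bounded_subset[of ?R]) (auto intro: bounded_Times)
  ultimately have "compact ?Z" by (simp add: compact_eq_bounded_closed)
  moreover have "?Z \<noteq> {}" using in_Z[of t x] t \<open>\<not> c < k x t\<close> by auto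
  ultimately obtain z where z: "z \<in> ?Z" "\<And>z'. z' \<in> ?Z \<Longrightarrow> snd z \<le> snd z'"
    using continuous_attains_inf[of ?Z snd] continuous_on_snd[OF continuous_on_id] by blast
  obtain x0 t0 where "z = (x0, t0)" by fastforce
  then have t0: "t0 \<in> {0..\<tau>}" and le: "k x0 t0 \<le> c" using z(1) by auto
  have before: "c < k y s" if "s \<in> {0..\<tau>}" "s < t0" for y s
    using in_Z[OF that(1), of y] z(2) that(2) \<open>z = (x0, t0)\<close> by fastforce
  have "t0 \<noteq> 0" using init[of x0] le by auto
  then have "0 < t0" using t0 by auto
  have ge: "c \<le> k y t0" for y
  proof (rule tendsto_lowerbound)
    have "continuous (at t0 within {0..\<tau>}) (k y)"
      using DERIV_continuous[OF dt[OF t0]] .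
    then show "(k y \<longlongrightarrow> k y t0) (at t0 within {0..<t0})"
      unfolding continuous_within by (rule tendsto_within_subset) (use t0 in auto)
    show "\<forall>\<^sub>F s in at t0 within {0..<t0}. c \<le> k y s"
      unfolding eventually_at_filter using before t0 by (auto intro!: always_eventually less_imp_le)
    show "at t0 within {0..<t0} \<noteq> bot"
      using \<open>0 < t0\<close> by (simp add: at_within_eq_bot_iff)
  qed
  have eq: "k x0 t0 = c" using ge[of x0] le by simp
  have "k1 x0 t0 = 0" "0 \<le> k2 x0 t0"
    using second_deriv_nonneg_at_minimum[OF d1[OF t0] d2[OF t0]] ge eq by auto
  then have "0 < kt x0 t0" using barrier[OF t0 eq] by simp
  then obtain d where d: "d > 0" "\<And>h. \<lbrakk>0 < h; t0 - h \<in> {0..\<tau>}; h < d\<rbrakk> \<Longrightarrow> k x0 (t0 - h) < k x0 t0"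
    using has_real_derivative_pos_inc_left[OF dt[OF t0, of x0]] by metis
  define h where "h = min (d / 2) t0"
  have "k x0 (t0 - h) < k x0 t0" using d \<open>0 < t0\<close> t0 by (intro d(2)) (auto simp: h_def)
  moreover have "c < k x0 (t0 - h)" using d \<open>0 < t0\<close> t0 by (intro before) (auto simp: h_def)
  ultimately show False using eq by simp
qed

section \<open>Integrals with variable end point or parameter\<close>

lemma interval_integral_has_derivative:
  fixes f :: "real \<Rightarrow> real"
  assumes "continuous_on UNIV f"
  shows "((\<lambda>u. LBINT y=0..u. f y) has_real_derivative f x) (at x)"
proof -
  have "((\<lambda>u. LBINT y=ereal 0..u. f y) has_vector_derivative f x) (at x within {- \<bar>x\<bar> - 1..\<bar>x\<bar> + 1})"
    by (rule interval_integral_FTC2) (use assms continuous_on_subset in auto)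
  moreover have "at x within {- \<bar>x\<bar> - 1..\<bar>x\<bar> + 1} = at x"
    by (rule at_within_Icc_at) auto
  ultimately show ?thesis
    by (simp add: has_real_derivative_iff_has_vector_derivative zero_ereal_def)
qed

lemma interval_integrable_of_continuous:
  fixes f :: "real \<Rightarrow> real"
  assumes "continuous_on UNIV f"
  shows "interval_lebesgue_integrable lborel 0 (ereal c) f"
proof -
  have "interval_lebesgue_integrable lborel (ereal 0) (ereal c) f"
    by (rule interval_integrable_isCont) (use assms in \<open>simp add: continuous_on_eq_continuous_at\<close>)
  then show ?thesis by (simp add: zero_ereal_def)
qed

lemma interval_integral_periodic:
  fixes f :: "real \<Rightarrow> real"
  assumes cont: "continuous_on UNIV f" and per: "\<And>x. f (x + d) = f x"
    and zero: "(LBINT y=0..ereal d. f y) = 0"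
  shows "(LBINT y=0..ereal (x + d). f y) = (LBINT y=0..ereal x. f y)"
proof -
  let ?G = "\<lambda>u. LBINT y=0..ereal u. f y"
  have "((\<lambda>x. ?G (x + d) - ?G x) has_real_derivative f (x + d) * 1 - f x) (at x)" for x
    by (intro DERIV_diff DERIV_chain2[where f="?G" and g="\<lambda>x. x + d"]
        interval_integral_has_derivative[OF cont]) (auto intro!: derivative_eq_intros)
  then have "\<forall>x. DERIV (\<lambda>x. ?G (x + d) - ?G x) x :> 0"
    by (simp add: per)
  then have "?G (x + d) - ?G x = ?G (0 + d) - ?G 0"
    by (rule DERIV_isconst_all)
  then show ?thesis using zero by (simp add: zero_ereal_def)
qed

text \<open>The end points may come in either order, since the angle \<open>\<theta>\<close> of the flow may be negative.\<close>
lemma interval_integral_eq_HK: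
  fixes f :: "real \<Rightarrow> real"
  assumes "continuous_on UNIV f"
  shows "(LBINT x=ereal a..ereal b. f x) = (if a \<le> b then 1 else - 1) * integral (cbox (min a b) (max a b)) f"
proof -
  have *: "(LBINT x=ereal c..ereal d. f x) = integral (cbox c d) f" if "c \<le> d" for c d
    using that borel_integrable_atLeastAtMost'[of c d f] continuous_on_subset[OF assms]
    by (auto simp: interval_integral_eq_integral)
  show ?thesis
    using *[of a b] *[of b a] interval_integral_endpoints_reverse[of a b f]
    by (auto simp: min_def max_def)
qed

lemma interval_integral_has_derivative_parameter:
  fixes f f' :: "real \<Rightarrow> real \<Rightarrow> real"
  assumes deriv: "\<And>x t. t \<in> U \<Longrightarrow> ((\<lambda>t. f x t) has_real_derivative f' x t) (at t within U)"
    and cont: "\<And>t. t \<in> U \<Longrightarrow> continuous_on UNIV (\<lambda>x. f x t)"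
    and cont': "continuous_on (UNIV \<times> U) (\<lambda>(x, t). f' x t)"
    and U: "convex U" "t \<in> U"
  shows "((\<lambda>s. LBINT x=ereal a..ereal b. f x s) has_real_derivative (LBINT x=ereal a..ereal b. f' x t))
           (at t within U)"
proof -
  let ?B = "cbox (min a b) (max a b)"
  let ?\<epsilon> = "if a \<le> b then 1 else - 1 :: real"
  have "continuous_on (U \<times> ?B) (\<lambda>z. (\<lambda>(x, t). f' x t) (snd z, fst z))"
    by (rule continuous_on_compose2[OF cont']) (auto intro!: continuous_intros)
  then have "((\<lambda>s. integral ?B (\<lambda>x. f x s)) has_real_derivative integral ?B (\<lambda>x. f' x t)) (at t within U)"
    using deriv cont U
    by (intro leibniz_rule_field_derivative integrable_continuous)
      (auto simp: case_prod_unfold intro: continuous_on_subset)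
  then have D: "((\<lambda>s. ?\<epsilon> * integral ?B (\<lambda>x. f x s)) has_real_derivative ?\<epsilon> * integral ?B (\<lambda>x. f' x t)) (at t within U)"
    by (rule DERIV_cmult)
  have "continuous_on UNIV (\<lambda>x. (\<lambda>(x, t). f' x t) (x, t))"
    by (rule continuous_on_compose2[OF cont']) (use U in \<open>auto intro!: continuous_intros\<close>)
  then have eq': "(LBINT x=ereal a..ereal b. f' x t) = ?\<epsilon> * integral ?B (\<lambda>x. f' x t)"
    by (subst interval_integral_eq_HK) simp_all
  show ?thesis
    unfolding eq'
    by (rule has_field_derivative_transform_within[OF D zero_less_one U(2)])
      (rule interval_integral_eq_HK[OF cont, symmetric])
qed

section \<open>The flow on a closed time interval\<close>

text \<open>The flow up to a time \<open>\<tau>\<close> before the final one, with names for the partial derivatives of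
  \<open>k\<close>.  Joint continuity of \<open>k2\<close> and \<open>kt\<close> stands for the Hoelder conditions; it gives the continuity of
  \<open>k\<close> and \<open>k1\<close>.\<close>
locale curvature_slab = minkowski_ball +
  fixes k k1 k2 kt :: "real \<Rightarrow> real \<Rightarrow> real" and \<tau> :: real
  assumes k_deriv: "t \<in> {0..\<tau>} \<Longrightarrow> ((\<lambda>x. k x t) has_real_derivative k1 x t) (at x)"
    and k1_deriv: "t \<in> {0..\<tau>} \<Longrightarrow> ((\<lambda>x. k1 x t) has_real_derivative k2 x t) (at x)"
    and k_deriv_t: "t \<in> {0..\<tau>} \<Longrightarrow> ((\<lambda>s. k x s) has_real_derivative kt x t) (at t within {0..\<tau>})"
    and k2_continuous: "continuous_on (UNIV \<times> {0..\<tau>}) (\<lambda>(x, t). k2 x t)"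
    and kt_continuous: "continuous_on (UNIV \<times> {0..\<tau>}) (\<lambda>(x, t). kt x t)"
    and k_periodic: "t \<in> {0..\<tau>} \<Longrightarrow> k (x + 2 * pi) t = k x t"
    and evolution: "t \<in> {0..\<tau>} \<Longrightarrow>
      kt x t = a x / (a x + deriv (deriv a) x) * (k x t)\<^sup>2 * k2 x t
        + 2 * deriv a x / (a x + deriv (deriv a) x) * (k x t)\<^sup>2 * k1 x t + (k x t) ^ 3"
    and initial_pos: "0 < k x 0"
    and initial_closed:
      "(LBINT x=0..2 * pi. (a x + deriv (deriv a) x) / k x 0 * sin x) = 0"
      "(LBINT x=0..2 * pi. (a x + deriv (deriv a) x) / k x 0 * cos x) = 0"
    and \<tau>_nonneg: "0 \<le> \<tau>"
begin

lemma k_continuous_space: "t \<in> {0..\<tau>} \<Longrightarrow> continuous_on A (\<lambda>x. k x t)"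
  by (intro continuous_at_imp_continuous_on ballI DERIV_isCont[OF k_deriv])

lemma k_continuous: "continuous_on (UNIV \<times> {0..\<tau>}) (\<lambda>(x, t). k x t)"
  by (rule continuous_on_joint_of_partial_deriv[OF k_deriv_t kt_continuous])
    (use k_continuous_space \<tau>_nonneg in auto)

lemma k_continuous_time: "continuous_on {0..\<tau>} (k x)"
  by (meson DERIV_continuous_on k_deriv_t)

lemma k1_continuous_time: "continuous_on {0..\<tau>} (k1 x)"
  by (rule continuous_on_partial_deriv_parameter[OF k_deriv k1_deriv k2_continuous k_continuous_time])

text \<open>The barrier is half of the initial minimum.  At a contact point the first-order term of the equation
  vanishes, the second-order term is nonnegative as \<open>a > 0\<close>, and \<open>c ^ 3\<close> remains.\<close>
lemma k_pos:
  assumes t: "t \<in> {0..\<tau>}"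
  shows "0 < k x t"
proof -
  have 0: "(0::real) \<in> {0..\<tau>}" using \<tau>_nonneg by simp
  have "\<exists>y\<in>{0..2 * pi}. \<forall>z\<in>{0..2 * pi}. k y 0 \<le> k z 0"
    by (rule continuous_attains_inf) (auto intro: k_continuous_space[OF 0])
  then obtain y where y: "\<And>z. z \<in> {0..2 * pi} \<Longrightarrow> k y 0 \<le> k z 0" by blast
  define c where "c = k y 0 / 2"
  have "0 < c" using initial_pos[of y] by (simp add: c_def)
  have init: "c < k x 0" for x
  proof -
    obtain z where "0 \<le> z" "z < 0 + 2 * pi" "k z 0 = k x 0"
      using periodic_2pi_representative[of "\<lambda>x. k x 0" 0 x, OF k_periodic[OF 0]] by auto
    then show ?thesis using y[of z] \<open>0 < c\<close> by (auto simp: c_def)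
  qed
  have "c < k x t"
  proof (rule periodic_barrier[OF k_deriv k1_deriv k_deriv_t k_continuous k_periodic init _ t])
    fix x t assume *: "t \<in> {0..\<tau>}" "k x t = c" "k1 x t = 0" "0 \<le> k2 x t"
    then have "kt x t = a x / (a x + deriv (deriv a) x) * c\<^sup>2 * k2 x t + c ^ 3"
      using evolution by simp
    then show "0 < kt x t"
      using * \<open>0 < c\<close> a_pos[of x] radius_pos[of x] by (auto intro!: add_nonneg_pos)
  qed
  then show ?thesis using \<open>0 < c\<close> by simp
qed

lemma density_continuous:
  assumes "t \<in> {0..\<tau>}" "continuous_on A w"
  shows "continuous_on A (\<lambda>x. (a x + deriv (deriv a) x) / k x t * w x)"
  using k_pos[OF assms(1)]
  by (intro continuous_intros a_continuous k_continuous_space assms) (simp add: less_imp_neq[symmetric])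

text \<open>With \<open>u = a k\<close> this is \<open>u' w - u w'\<close>, which for \<open>w'' = - w\<close> has derivative \<open>(u'' + u) w\<close>.\<close>
definition flux :: "(real \<Rightarrow> real) \<Rightarrow> (real \<Rightarrow> real) \<Rightarrow> real \<Rightarrow> real \<Rightarrow> real" where
  "flux w w' x t = (deriv a x * k x t + a x * k1 x t) * w x - a x * k x t * w' x"

text \<open>By the evolution equation \<open>(a + a'') k\<^sub>t / k\<^sup>2 = a k'' + 2 a' k' + (a + a'') k = u'' + u\<close> for
  \<open>u = a k\<close>, so the integrand has the time derivative \<open>- (u'' + u) w\<close>, whose antiderivative in space is
  minus the flux.  Sine and cosine are treated together, as functions with \<open>w'' = - w\<close>.\<close>
lemma density_moment_deriv:
  assumes w: "\<And>x. (w has_real_derivative w' x) (at x)" "\<And>x. (w' has_real_derivative - w x) (at x)"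
    and t: "t \<in> {0..\<tau>}"
  shows "((\<lambda>s. LBINT x=0..\<theta>. (a x + deriv (deriv a) x) / k x s * w x) has_real_derivative
           flux w w' 0 t - flux w w' \<theta> t) (at t within {0..\<tau>})"
proof -
  \<comment> \<open>the time derivative of the integrand, before the evolution equation is used\<close>
  define f' where "f' x t = - ((a x + deriv (deriv a) x) * w x / (k x t)\<^sup>2 * kt x t)" for x t
  have w_cont: "continuous_on A w" for A
    by (intro continuous_at_imp_continuous_on ballI DERIV_isCont[OF w(1)])
  have "((\<lambda>s. LBINT x=ereal 0..\<theta>. (a x + deriv (deriv a) x) / k x s * w x) has_real_derivative
           (LBINT x=ereal 0..\<theta>. f' x t)) (at t within {0..\<tau>})"
  proof (rule interval_integral_has_derivative_parameter)
    show "((\<lambda>s. (a x + deriv (deriv a) x) / k x s * w x) has_real_derivative f' x s) (at s within {0..\<tau>})"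
      if "s \<in> {0..\<tau>}" for x s
      using k_pos[OF that, of x]
      by (auto intro!: derivative_eq_intros k_deriv_t[OF that] simp: f'_def power2_eq_square)
    show "continuous_on UNIV (\<lambda>x. (a x + deriv (deriv a) x) / k x s * w x)" if "s \<in> {0..\<tau>}" for s
      by (rule density_continuous[OF that w_cont])
    have "continuous_on (UNIV \<times> {0..\<tau>}) (\<lambda>p. a (fst p) + deriv (deriv a) (fst p))"
      by (rule continuous_on_compose2[OF a_continuous(3)[of UNIV]]) (auto intro!: continuous_intros)
    moreover have "continuous_on (UNIV \<times> {0..\<tau>}) (\<lambda>p. w (fst p))"
      by (rule continuous_on_compose2[OF w_cont[of UNIV]]) (auto intro!: continuous_intros)
    moreover have "k x t \<noteq> 0" if "t \<in> {0..\<tau>}" for x t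
      using k_pos[OF that, of x] by simp
    ultimately show "continuous_on (UNIV \<times> {0..\<tau>}) (\<lambda>(x, t). f' x t)"
      using k_continuous kt_continuous unfolding f'_def case_prod_unfold
      by (intro continuous_on_mult continuous_on_divide continuous_on_minus continuous_on_power) auto
  qed (use t in auto)
  moreover have "(LBINT x=ereal 0..\<theta>. f' x t) = - flux w w' \<theta> t - (- flux w w' 0 t)"
  proof (rule interval_integral_FTC_finite)
    have f'_eq: "f' x t = - ((a x * k2 x t + 2 * deriv a x * k1 x t + (a x + deriv (deriv a) x) * k x t) * w x)" for x
      using radius_pos[of x] k_pos[OF t, of x] unfolding f'_def evolution[OF t]
      by (simp add: divide_simps) (simp add: algebra_simps power2_eq_square power3_eq_cube)
    have "continuous_on A (\<lambda>x. (\<lambda>(x, t). k2 x t) (x, t))" for A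
      by (rule continuous_on_compose2[OF k2_continuous]) (use t in \<open>auto intro!: continuous_intros\<close>)
    then have k2_space: "continuous_on A (\<lambda>x. k2 x t)" for A by simp
    have k1_space: "continuous_on A (\<lambda>x. k1 x t)" for A
      by (intro continuous_at_imp_continuous_on ballI DERIV_isCont[OF k1_deriv[OF t]])
    show "continuous_on {min 0 \<theta>..max 0 \<theta>} (\<lambda>x. f' x t)"
      unfolding f'_eq
      by (intro continuous_intros a_continuous w_cont k_continuous_space[OF t] k1_space k2_space)
    have "((\<lambda>x. - flux w w' x t) has_real_derivative f' x t) (at x)" for x
      unfolding flux_def f'_eq
      by (auto intro!: derivative_eq_intros a_deriv a_deriv2 k_deriv[OF t] k1_deriv[OF t] w
          simp: algebra_simps)
    then show "((\<lambda>x. - flux w w' x t) has_vector_derivative f' x t) (at x within {min 0 \<theta>..max 0 \<theta>})" for x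
      by (simp add: has_real_derivative_iff_has_vector_derivative has_vector_derivative_at_within)
  qed
  ultimately show ?thesis by (simp add: zero_ereal_def)
qed

lemma flux_periodic:
  assumes "t \<in> {0..\<tau>}" "\<And>x. w (x + 2 * pi) = w x" "\<And>x. w' (x + 2 * pi) = w' x"
  shows "flux w w' (x + 2 * pi) t = flux w w' x t"
proof -
  have "k1 (x + 2 * pi) t = k1 x t"
    by (rule vector_derivative_of_periodic[of "\<lambda>x. k x t" "2 * pi" "\<lambda>x. k1 x t", OF k_periodic[OF assms(1)]])
      (rule k_deriv[OF assms(1), unfolded has_real_derivative_iff_has_vector_derivative])
  then show ?thesis
    using assms k_periodic[OF assms(1)] by (simp add: flux_def a_periodic)
qed

text \<open>Over a full period the flux at the two ends cancels, so the moment keeps its initial value.\<close>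
lemma density_moment_zero:
  assumes w: "\<And>x. (w has_real_derivative w' x) (at x)" "\<And>x. (w' has_real_derivative - w x) (at x)"
    and per: "\<And>x. w (x + 2 * pi) = w x" "\<And>x. w' (x + 2 * pi) = w' x"
    and init: "(LBINT x=0..ereal (2 * pi). (a x + deriv (deriv a) x) / k x 0 * w x) = 0"
    and t: "t \<in> {0..\<tau>}"
  shows "(LBINT x=0..ereal (2 * pi). (a x + deriv (deriv a) x) / k x t * w x) = 0"
proof -
  let ?M = "\<lambda>s. LBINT x=0..ereal (2 * pi). (a x + deriv (deriv a) x) / k x s * w x"
  have "(?M has_real_derivative 0) (at s within {0..\<tau>})" if "s \<in> {0..\<tau>}" for s
    using density_moment_deriv[OF w that, of "2 * pi"] flux_periodic[of s w w' 0, OF that per] by simp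
  then obtain c where "\<And>s. s \<in> {0..\<tau>} \<Longrightarrow> ?M s = c"
    using has_field_derivative_zero_constant[of "{0..\<tau>}" ?M] by auto
  then show ?thesis using t init \<tau>_nonneg by force
qed

lemma density_moments_zero:
  assumes "t \<in> {0..\<tau>}"
  shows "(LBINT x=0..ereal (2 * pi). (a x + deriv (deriv a) x) / k x t * sin x) = 0"
    and "(LBINT x=0..ereal (2 * pi). (a x + deriv (deriv a) x) / k x t * cos x) = 0"
proof -
  show "(LBINT x=0..ereal (2 * pi). (a x + deriv (deriv a) x) / k x t * sin x) = 0"
    by (rule density_moment_zero[of sin cos])
      (use assms initial_closed in \<open>auto intro!: derivative_eq_intros\<close>)
  show "(LBINT x=0..ereal (2 * pi). (a x + deriv (deriv a) x) / k x t * cos x) = 0"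
    by (rule density_moment_zero[of cos "\<lambda>x. - sin x"])
      (use assms initial_closed in \<open>auto intro!: derivative_eq_intros\<close>)
qed

lemma d_theta_k: "t \<in> {0..\<tau>} \<Longrightarrow> d_theta k x t = k1 x t"
  unfolding d_theta_def by (rule DERIV_imp_deriv[OF k_deriv])

lemma time_integrands_continuous:
  "continuous_on {0..\<tau>} (\<lambda>s. a 0 * k 0 s)"
  "continuous_on {0..\<tau>} (\<lambda>s. a 0 * d_theta k 0 s + deriv a 0 * k 0 s)"
proof -
  show "continuous_on {0..\<tau>} (\<lambda>s. a 0 * k 0 s)"
    by (intro continuous_intros k_continuous_time)
  have "continuous_on {0..\<tau>} (\<lambda>s. a 0 * k1 0 s + deriv a 0 * k 0 s)"
    by (intro continuous_intros k_continuous_time k1_continuous_time)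
  then show "continuous_on {0..\<tau>} (\<lambda>s. a 0 * d_theta k 0 s + deriv a 0 * k 0 s)"
    by (rule continuous_on_eq) (simp add: d_theta_k)
qed

lemma flow_integrable:
  assumes t: "t \<in> {0..\<tau>}"
  shows "interval_lebesgue_integrable lborel 0 (ereal \<theta>)
           (\<lambda>\<sigma>. (a \<sigma> + deriv (deriv a) \<sigma>) / k \<sigma> t * sin \<sigma>)"
    and "interval_lebesgue_integrable lborel 0 (ereal \<theta>)
           (\<lambda>\<sigma>. (a \<sigma> + deriv (deriv a) \<sigma>) / k \<sigma> t * cos \<sigma>)"
    and "interval_lebesgue_integrable lborel 0 (ereal t) (\<lambda>s. a 0 * k 0 s)"
    and "interval_lebesgue_integrable lborel 0 (ereal t) (\<lambda>s. a 0 * d_theta k 0 s + deriv a 0 * k 0 s)"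
proof -
  show "interval_lebesgue_integrable lborel 0 (ereal \<theta>)
           (\<lambda>\<sigma>. (a \<sigma> + deriv (deriv a) \<sigma>) / k \<sigma> t * sin \<sigma>)"
    "interval_lebesgue_integrable lborel 0 (ereal \<theta>)
           (\<lambda>\<sigma>. (a \<sigma> + deriv (deriv a) \<sigma>) / k \<sigma> t * cos \<sigma>)"
    by (intro interval_integrable_of_continuous density_continuous[OF t] continuous_intros)+
  have "interval_lebesgue_integrable lborel (ereal 0) (ereal t) f" if "continuous_on {0..\<tau>} f" for f :: "real \<Rightarrow> real"
    by (rule interval_integrable_continuous_on) (use t continuous_on_subset[OF that] in auto)
  then show "interval_lebesgue_integrable lborel 0 (ereal t) (\<lambda>s. a 0 * k 0 s)"
    "interval_lebesgue_integrable lborel 0 (ereal t) (\<lambda>s. a 0 * d_theta k 0 s + deriv a 0 * k 0 s)"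
    using time_integrands_continuous by (simp_all add: zero_ereal_def)
qed

lemma frame_tangent_flow:
  assumes t: "t \<in> {0..\<tau>}"
  shows "frame_tangent_curve (\<lambda>\<theta>. minkowski_flow a k \<theta> t) (\<lambda>\<theta>. (a \<theta> + deriv (deriv a) \<theta>) / k \<theta> t)"
proof
  fix \<theta> :: real
  let ?\<rho> = "\<lambda>\<theta>. (a \<theta> + deriv (deriv a) \<theta>) / k \<theta> t"
  have cont: "continuous_on UNIV (\<lambda>x. ?\<rho> x * sin x)" "continuous_on UNIV (\<lambda>x. ?\<rho> x * cos x)"
    by (intro density_continuous[OF t] continuous_intros)+
  show "minkowski_flow a k (\<theta> + 2 * pi) t = minkowski_flow a k \<theta> t"
    unfolding minkowski_flow_def
    by (subst (1 2) interval_integral_periodic)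
      (use cont density_moments_zero[OF t] in \<open>auto simp: a_periodic k_periodic[OF t]\<close>)
  show "0 < ?\<rho> \<theta>" using radius_pos k_pos[OF t] by simp
  have "((\<lambda>\<theta>. minkowski_flow a k \<theta> t) has_vector_derivative
      vector [- (?\<rho> \<theta> * sin \<theta>) - 0, ?\<rho> \<theta> * cos \<theta> - 0]) (at \<theta>)"
    unfolding minkowski_flow_def
    by (intro has_vector_derivative_vector_2 DERIV_diff DERIV_minus DERIV_const
        interval_integral_has_derivative[OF cont(1)] interval_integral_has_derivative[OF cont(2)])
  then show "((\<lambda>\<theta>. minkowski_flow a k \<theta> t) has_vector_derivative ?\<rho> \<theta> *\<^sub>R e_theta \<theta>) (at \<theta>)"
    by (rule has_vector_derivative_eq_rhs) (simp add: e_theta_def vec_eq_iff forall_2)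
qed

text \<open>As \<open>q = e\<^sub>\<theta> / a\<close>, the speed in the direction \<open>q\<close> is \<open>a (a + a'') / k\<close>, that is \<open>[p, p'] / k\<close>.\<close>
lemma flow_curvature:
  assumes t: "t \<in> {0..\<tau>}"
  shows "has_minkowski_curvature a (\<lambda>\<theta>. minkowski_flow a k \<theta> t) (\<lambda>\<theta>. k \<theta> t)"
proof -
  interpret frame_tangent_curve "\<lambda>\<theta>. minkowski_flow a k \<theta> t" "\<lambda>\<theta>. (a \<theta> + deriv (deriv a) \<theta>) / k \<theta> t"
    by (rule frame_tangent_flow[OF t])
  define l where "l \<theta> = a \<theta> * ((a \<theta> + deriv (deriv a) \<theta>) / k \<theta> t)" for \<theta>
  have "0 < l \<theta>" for \<theta>
    using a_pos[of \<theta>] pos[of \<theta>] unfolding l_def by (rule mult_pos_pos)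
  moreover have "l \<theta> *\<^sub>R q_curve a \<theta> = ((a \<theta> + deriv (deriv a) \<theta>) / k \<theta> t) *\<^sub>R e_theta \<theta>" for \<theta>
    using a_pos[of \<theta>] by (simp add: q_curve_eq l_def)
  moreover have "k \<theta> t = det2 (p_curve a \<theta>) (p_curve' a \<theta>) / l \<theta>" for \<theta>
    using a_pos[of \<theta>] radius_pos[of \<theta>] by (simp add: det2_p_p' l_def)
  ultimately show ?thesis
    unfolding has_minkowski_curvature_def using deriv by (intro exI[of _ l]) auto
qed

text \<open>The two time integrals have the derivatives \<open>u\<close> and \<open>u'\<close> at the angle \<open>0\<close>, where \<open>u = a k\<close>; these
  cancel the fluxes at \<open>0\<close>.  The fluxes at \<open>\<theta>\<close> are, up to sign, the coordinates of \<open>- u e\<^sub>r - u' e\<^sub>\<theta>\<close>, and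
  \<open>u' = a' k + a k'\<close> splits this into \<open>- k p\<close> and \<open>- a k' e\<^sub>\<theta> = - a\<^sup>2 k' q\<close>.\<close>
lemma flow_velocity:
  assumes t: "t \<in> {0..\<tau>}"
  shows "((\<lambda>s. minkowski_flow a k \<theta> s) has_vector_derivative
          - (k \<theta> t *\<^sub>R p_curve a \<theta>) - ((a \<theta>)\<^sup>2 * d_theta k \<theta> t) *\<^sub>R q_curve a \<theta>)
         (at t within {0..\<tau>})"
proof -
  have time: "((\<lambda>u. LBINT s=0..ereal u. f s) has_real_derivative f t) (at t within {0..\<tau>})"
    if "continuous_on {0..\<tau>} f" for f :: "real \<Rightarrow> real"
    using interval_integral_FTC2[of 0 0 \<tau> f t] that t
    by (simp add: has_real_derivative_iff_has_vector_derivative zero_ereal_def)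
  have S: "((\<lambda>s. LBINT x=0..\<theta>. (a x + deriv (deriv a) x) / k x s * sin x) has_real_derivative
           flux sin cos 0 t - flux sin cos \<theta> t) (at t within {0..\<tau>})"
    by (rule density_moment_deriv[OF _ _ t]) (auto intro!: derivative_eq_intros)
  have C: "((\<lambda>s. LBINT x=0..\<theta>. (a x + deriv (deriv a) x) / k x s * cos x) has_real_derivative
           flux cos (\<lambda>x. - sin x) 0 t - flux cos (\<lambda>x. - sin x) \<theta> t) (at t within {0..\<tau>})"
    by (rule density_moment_deriv[OF _ _ t]) (auto intro!: derivative_eq_intros)
  have "((\<lambda>s. minkowski_flow a k \<theta> s) has_vector_derivative
     vector [- (flux sin cos 0 t - flux sin cos \<theta> t) - a 0 * k 0 t,
       (flux cos (\<lambda>x. - sin x) 0 t - flux cos (\<lambda>x. - sin x) \<theta> t) - (a 0 * d_theta k 0 t + deriv a 0 * k 0 t)])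
     (at t within {0..\<tau>})"
    unfolding minkowski_flow_def
    by (intro has_vector_derivative_vector_2 DERIV_diff DERIV_minus S C time time_integrands_continuous)
  then show ?thesis
  proof (rule has_vector_derivative_eq_rhs)
    have "((a \<theta>)\<^sup>2 * d_theta k \<theta> t) *\<^sub>R q_curve a \<theta> = (a \<theta> * k1 \<theta> t) *\<^sub>R e_theta \<theta>"
      using a_pos[of \<theta>] by (simp add: q_curve_eq d_theta_k[OF t] power2_eq_square)
    then show "vector [- (flux sin cos 0 t - flux sin cos \<theta> t) - a 0 * k 0 t,
       (flux cos (\<lambda>x. - sin x) 0 t - flux cos (\<lambda>x. - sin x) \<theta> t) - (a 0 * d_theta k 0 t + deriv a 0 * k 0 t)]
      = - (k \<theta> t *\<^sub>R p_curve a \<theta>) - ((a \<theta>)\<^sup>2 * d_theta k \<theta> t) *\<^sub>R q_curve a \<theta>"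
      by (simp only:) (simp add: vec_eq_iff forall_2 flux_def d_theta_k[OF t] p_curve_def e_r_def e_theta_def algebra_simps)
  qed
qed

end

section \<open>The family of curves on the half-open time interval\<close>

text \<open>The derivatives in the regularity assumption are some functions that may depend on \<open>\<tau>\<close>; uniqueness of
  derivatives identifies them with those in the evolution equation.\<close>
lemma curvature_slab_of_flow:
  fixes k :: "real \<Rightarrow> real \<Rightarrow> real"
  assumes ball: "minkowski_ball a"
    and \<alpha>: "0 < \<alpha>" and \<tau>: "0 < \<tau>" "\<tau> < T"
    and reg: "holder_C2_C1 \<alpha> \<tau> k"
    and evol: "\<forall>\<theta>. \<forall>t\<in>{0..<T}.
           ((\<lambda>s. k \<theta> s) has_real_derivative
              a \<theta> / (a \<theta> + deriv (deriv a) \<theta>) * (k \<theta> t)\<^sup>2 * d_theta (d_theta k) \<theta> t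
              + 2 * deriv a \<theta> / (a \<theta> + deriv (deriv a) \<theta>) * (k \<theta> t)\<^sup>2 * d_theta k \<theta> t
              + (k \<theta> t) ^ 3) (at t within {0..<T})"
    and pos: "\<And>\<theta>. 0 < k \<theta> 0"
    and closed: "(LBINT \<theta>=0..2 * pi. (a \<theta> + deriv (deriv a) \<theta>) / k \<theta> 0 * sin \<theta>) = 0"
      "(LBINT \<theta>=0..2 * pi. (a \<theta> + deriv (deriv a) \<theta>) / k \<theta> 0 * cos \<theta>) = 0"
  obtains k1 k2 kt where "curvature_slab a k k1 k2 kt \<tau>"
proof -
  obtain k1 k2 kt where
    d: "\<And>\<theta> t. t \<in> {0..\<tau>} \<Longrightarrow> ((\<lambda>x. k x t) has_real_derivative k1 \<theta> t) (at \<theta>)"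
       "\<And>\<theta> t. t \<in> {0..\<tau>} \<Longrightarrow> ((\<lambda>x. k1 x t) has_real_derivative k2 \<theta> t) (at \<theta>)"
       "\<And>\<theta> t. t \<in> {0..\<tau>} \<Longrightarrow> ((\<lambda>s. k \<theta> s) has_real_derivative kt \<theta> t) (at t within {0..\<tau>})"
    and h: "holder_on \<alpha> (UNIV \<times> {0..\<tau>}) (\<lambda>(\<theta>, t). k2 \<theta> t)"
      "holder_on \<alpha> (UNIV \<times> {0..\<tau>}) (\<lambda>(\<theta>, t). kt \<theta> t)"
    using reg unfolding holder_C2_C1_def by blast
  have d1: "d_theta k \<theta> t = k1 \<theta> t" if "t \<in> {0..\<tau>}" for \<theta> t
    unfolding d_theta_def by (rule DERIV_imp_deriv[OF d(1)[OF that]])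
  have d2: "d_theta (d_theta k) \<theta> t = k2 \<theta> t" if "t \<in> {0..\<tau>}" for \<theta> t
    unfolding d_theta_def[of "d_theta k"] d1[OF that] by (rule DERIV_imp_deriv[OF d(2)[OF that]])
  have evol': "kt \<theta> t = a \<theta> / (a \<theta> + deriv (deriv a) \<theta>) * (k \<theta> t)\<^sup>2 * k2 \<theta> t
      + 2 * deriv a \<theta> / (a \<theta> + deriv (deriv a) \<theta>) * (k \<theta> t)\<^sup>2 * k1 \<theta> t + (k \<theta> t) ^ 3"
    if t: "t \<in> {0..\<tau>}" for \<theta> t
  proof (rule has_field_derivative_unique[OF d(3)[OF t]])
    have "t \<in> {0..<T}" using t \<tau> by auto
    from evol[rule_format, OF this, of \<theta>]
    show "((\<lambda>s. k \<theta> s) has_real_derivative a \<theta> / (a \<theta> + deriv (deriv a) \<theta>) * (k \<theta> t)\<^sup>2 * k2 \<theta> t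
      + 2 * deriv a \<theta> / (a \<theta> + deriv (deriv a) \<theta>) * (k \<theta> t)\<^sup>2 * k1 \<theta> t + (k \<theta> t) ^ 3) (at t within {0..\<tau>})"
      unfolding d1[OF t] d2[OF t] by (rule has_field_derivative_subset) (use \<tau> in auto)
    show "at t within {0..\<tau>} \<noteq> bot"
      using t \<tau> by (simp add: trivial_limit_within islimpt_Icc)
  qed
  interpret minkowski_ball a by (rule ball)
  have "curvature_slab a k k1 k2 kt \<tau>"
  proof
    show "continuous_on (UNIV \<times> {0..\<tau>}) (\<lambda>(x, t). k2 x t)"
      "continuous_on (UNIV \<times> {0..\<tau>}) (\<lambda>(x, t). kt x t)"
      by (rule holder_on_imp_continuous_on[OF _ \<alpha>], rule h)+
    show "k (x + 2 * pi) t = k x t" if "t \<in> {0..\<tau>}" for x t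
      using reg that unfolding holder_C2_C1_def by blast
  qed (use d evol' pos closed \<tau> in auto)
  then show thesis by (rule that)
qed

theorem theorem6p1:
  fixes P :: "(real ^ 2) set" and a \<phi> :: "real \<Rightarrow> real"
    and k :: "real \<Rightarrow> real \<Rightarrow> real" and T \<alpha> :: real
  assumes "strictly_convex P" and "\<forall>x\<in>P. - x \<in> P"
    and "a = support_function P"
    and "smooth_curve (p_curve a)" and "frontier P = range (p_curve a)"
    and "\<forall>\<theta>. a \<theta> + deriv (deriv a) \<theta> > 0"
    and "0 < \<alpha>" and "\<alpha> < 1" and "0 < T"
    and "\<forall>\<epsilon>>0. holder_C2_C1 \<alpha> (T - \<epsilon>) k"
    and "\<forall>\<theta>. \<forall>t\<in>{0..<T}.
           ((\<lambda>s. k \<theta> s) has_real_derivative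
              a \<theta> / (a \<theta> + deriv (deriv a) \<theta>) * (k \<theta> t)\<^sup>2 * d_theta (d_theta k) \<theta> t
              + 2 * deriv a \<theta> / (a \<theta> + deriv (deriv a) \<theta>) * (k \<theta> t)\<^sup>2 * d_theta k \<theta> t
              + (k \<theta> t) ^ 3) (at t within {0..<T})"
    and "\<forall>\<theta>. k \<theta> 0 = \<phi> \<theta>"
    and "\<forall>\<theta>. \<phi> \<theta> > 0" and "holder_C1 \<alpha> \<phi>"
    and "(LBINT \<theta>=0..2 * pi. (a \<theta> + deriv (deriv a) \<theta>) / \<phi> \<theta> * sin \<theta>) = 0"
    and "(LBINT \<theta>=0..2 * pi. (a \<theta> + deriv (deriv a) \<theta>) / \<phi> \<theta> * cos \<theta>) = 0"
  shows
    \<comment> \<open>the first conjunct: the integrals defining the curves exist\<close>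
    "(\<forall>t\<in>{0..<T}. \<forall>\<theta>::real.
       interval_lebesgue_integrable lborel 0 \<theta>
         (\<lambda>\<sigma>. (a \<sigma> + deriv (deriv a) \<sigma>) / k \<sigma> t * sin \<sigma>) \<and>
       interval_lebesgue_integrable lborel 0 \<theta>
         (\<lambda>\<sigma>. (a \<sigma> + deriv (deriv a) \<sigma>) / k \<sigma> t * cos \<sigma>) \<and>
       interval_lebesgue_integrable lborel 0 t (\<lambda>s. a 0 * k 0 s) \<and>
       interval_lebesgue_integrable lborel 0 t (\<lambda>s. a 0 * d_theta k 0 s + deriv a 0 * k 0 s)) \<and>
     (\<forall>t\<in>{0..<T}.
       simple_closed_curve (\<lambda>\<theta>. minkowski_flow a k \<theta> t) \<and>
       strictly_convex_curve (\<lambda>\<theta>. minkowski_flow a k \<theta> t) \<and>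
       has_minkowski_curvature a (\<lambda>\<theta>. minkowski_flow a k \<theta> t) (\<lambda>\<theta>. k \<theta> t)) \<and>
     (\<forall>t\<in>{0..<T}. \<forall>\<theta>.
       ((\<lambda>s. minkowski_flow a k \<theta> s) has_vector_derivative
          - (k \<theta> t *\<^sub>R p_curve a \<theta>) - ((a \<theta>)\<^sup>2 * d_theta k \<theta> t) *\<^sub>R q_curve a \<theta>)
         (at t within {0..<T}))"
proof -
  have ball: "minkowski_ball a"
  proof
    show "a (x + pi) = a x" for x
      using support_function_antipodal[OF assms(2)] assms(3) by simp
  qed (use support_function_regular[OF assms(4)] assms(6) in auto)
  have k0: "k \<theta> 0 = \<phi> \<theta>" for \<theta> using assms(12) by simp
  have slab: "\<exists>\<tau> k1 k2 kt. t < \<tau> \<and> \<tau> < T \<and> curvature_slab a k k1 k2 kt \<tau>" if t: "t \<in> {0..<T}" for t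
  proof -
    define \<tau> where "\<tau> = (t + T) / 2"
    have \<tau>: "0 < \<tau>" "\<tau> < T" "t < \<tau>" using t by (auto simp: \<tau>_def)
    have "holder_C2_C1 \<alpha> \<tau> k" using assms(10)[rule_format, of "T - \<tau>"] \<tau> by simp
    then obtain k1 k2 kt where "curvature_slab a k k1 k2 kt \<tau>"
      using curvature_slab_of_flow[OF ball assms(7) \<tau>(1,2) _ assms(11)] assms(13,15,16)
      unfolding k0 by metis
    then show ?thesis using \<tau> by blast
  qed
  show ?thesis
  proof (intro conjI ballI allI)
    fix t \<theta> :: real assume t: "t \<in> {0..<T}"
    obtain \<tau> k1 k2 kt where \<tau>: "t < \<tau>" "\<tau> < T" and "curvature_slab a k k1 k2 kt \<tau>"
      using slab[OF t] by blast
    then interpret curvature_slab a k k1 k2 kt \<tau> by simp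
    have t': "t \<in> {0..\<tau>}" using t \<tau> by auto
    interpret curve: frame_tangent_curve "\<lambda>\<theta>. minkowski_flow a k \<theta> t"
      "\<lambda>\<theta>. (a \<theta> + deriv (deriv a) \<theta>) / k \<theta> t"
      by (rule frame_tangent_flow[OF t'])
    show "interval_lebesgue_integrable lborel 0 \<theta>
         (\<lambda>\<sigma>. (a \<sigma> + deriv (deriv a) \<sigma>) / k \<sigma> t * sin \<sigma>)"
      "interval_lebesgue_integrable lborel 0 \<theta>
         (\<lambda>\<sigma>. (a \<sigma> + deriv (deriv a) \<sigma>) / k \<sigma> t * cos \<sigma>)"
      "interval_lebesgue_integrable lborel 0 t (\<lambda>s. a 0 * k 0 s)"
      "interval_lebesgue_integrable lborel 0 t (\<lambda>s. a 0 * d_theta k 0 s + deriv a 0 * k 0 s)"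
      by (rule flow_integrable[OF t'])+
    show "simple_closed_curve (\<lambda>\<theta>. minkowski_flow a k \<theta> t)" by (rule curve.simple_closed)
    show "strictly_convex_curve (\<lambda>\<theta>. minkowski_flow a k \<theta> t)" by (rule curve.strictly_convex)
    show "has_minkowski_curvature a (\<lambda>\<theta>. minkowski_flow a k \<theta> t) (\<lambda>\<theta>. k \<theta> t)"
      by (rule flow_curvature[OF t'])
    \<comment> \<open>The two time intervals agree near \<open>t\<close>, because \<open>t < \<tau> < T\<close>.\<close>
    have "at t within {0..<T} = at t within {0..\<tau>}"
      by (rule at_within_nhd[of t "{..<\<tau>}"]) (use \<tau> in auto)
    then show "((\<lambda>s. minkowski_flow a k \<theta> s) has_vector_derivative
          - (k \<theta> t *\<^sub>R p_curve a \<theta>) - ((a \<theta>)\<^sup>2 * d_theta k \<theta> t) *\<^sub>R q_curve a \<theta>)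
         (at t within {0..<T})"
      using flow_velocity[OF t'] by simp
  qed
qed

end
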